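(* For every integer $a \geq 0$, the position $(a,a,a)$ of the game Twyst-off is a $P$ position.
   Context: Twyst-off is a two-player impartial game (players alternate; normal play: the last player to move legally wins). A position is a finite ordered sequence $(s_1,\dots,s_n)$ of stacks of tiles, with stack sizes nonnegative integers. Positions are subject to the identifications: an end stack of size $0$ is deleted; an interior stack of size $0$ is deleted and its two neighbors are combined, i.e. $(\dots,x,0,y,\dots)=(\dots,x+y,\dots)$. Thus every position equals a (possibly empty) sequence of positive integers. From a sequence of positive integers, a move is one of: (i) remove $k\ge 1$ tiles from the first or from the last stack; (ii) remove the same number $k\ge 1$ of tiles from two consecutive stacks; after which the identifications are applied. A position is $P$ if the previous (second) player can force a win, equivalently if none of its options (positions reachable in one move) is $P$; it is $N$ if the next (first) player can force a win, equivalently if some option is $P$. *)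

theory Defs
  imports Main
begin

section \<open>Positions\<close>

text \<open>A position is represented by a list of natural numbers. The relation \<open>identify\<close> performs
  a single identification: it deletes an empty end stack, or deletes an empty interior stack and
  combines its two neighbours.\<close>

inductive identify :: "nat list \<Rightarrow> nat list \<Rightarrow> bool" where
  identify_first: "identify (0 # xs) xs"
| identify_last: "identify (xs @ [0]) xs"
| identify_interior: "identify (xs @ x # 0 # y # ys) (xs @ (x + y) # ys)"

text \<open>\<open>canon xs\<close> is the sequence of positive integers that \<open>xs\<close> equals as a position. By
  \<open>canon_unique\<close> it is the only zero-free list reachable from \<open>xs\<close> by identifications, and by
  \<open>same_position_iff\<close> two lists represent the same position iff they have the same \<open>canon\<close>.\<close>

fun canon :: "nat list \<Rightarrow> nat list" where
  "canon [] = []"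
| "canon (0 # xs) = canon xs"
| "canon [Suc x] = [Suc x]"
| "canon [Suc x, 0] = [Suc x]"
| "canon (Suc x # 0 # y # ys) = canon ((Suc x + y) # ys)"
| "canon (Suc x # Suc y # ys) = Suc x # canon (Suc y # ys)"

lemma canon_positive: "0 \<notin> set (canon xs)"
  by (induction xs rule: canon.induct) auto

lemma canon_id: "0 \<notin> set xs \<Longrightarrow> canon xs = xs"
  by (induction xs rule: canon.induct) auto

lemma sum_list_canon: "sum_list (canon xs) = sum_list xs"
  by (induction xs rule: canon.induct) auto

lemma identify_canon_prefix:
  "xs \<noteq> [] \<Longrightarrow> hd xs \<noteq> 0 \<Longrightarrow> identify\<^sup>*\<^sup>* (p @ xs) (p @ canon xs)"
proof (induction xs arbitrary: p rule: canon.induct)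
  case (4 x)
  show ?case using identify_last[of "p @ [Suc x]"] by auto
next
  case (5 x y ys)
  have "identify\<^sup>*\<^sup>* (p @ (Suc x + y) # ys) (p @ canon ((Suc x + y) # ys))"
    using 5 by simp
  then show ?case
    using identify_interior[of p "Suc x" y ys] by (simp add: converse_rtranclp_into_rtranclp)
next
  case (6 x y ys)
  show ?case using "6.IH"[of "p @ [Suc x]"] by simp
qed auto

lemma identify_canon: "identify\<^sup>*\<^sup>* xs (canon xs)"
proof (induction xs)
  case (Cons x xs)
  show ?case
  proof (cases x)
    case 0
    then show ?thesis
      using identify_first[of xs] Cons by (simp add: converse_rtranclp_into_rtranclp)
  next
    case (Suc n)
    then show ?thesis using identify_canon_prefix[of "x # xs" "[]"] by simp
  qed
qed simp

lemma canon_snoc_0: "canon (xs @ [0]) = canon xs"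
  by (induction xs rule: canon.induct) auto

lemma canon_interior: "canon (xs @ x # 0 # y # ys) = canon (xs @ (x + y) # ys)"
proof (induction xs rule: canon.induct)
  case 1
  show ?case by (cases x) auto
next
  case (3 a)
  show ?case by (cases x) auto
qed (auto simp: add.assoc)

lemma canon_identify: "identify xs ys \<Longrightarrow> canon xs = canon ys"
  by (induction rule: identify.induct) (simp_all add: canon_snoc_0 canon_interior)

lemma canon_identify_rtranclp: "identify\<^sup>*\<^sup>* xs ys \<Longrightarrow> canon xs = canon ys"
  by (induction rule: rtranclp_induct) (auto dest: canon_identify)

lemma canon_unique: "identify\<^sup>*\<^sup>* xs ys \<and> 0 \<notin> set ys \<longleftrightarrow> ys = canon xs"
  by (metis canon_id canon_identify_rtranclp canon_positive identify_canon)

lemma same_position_iff: "equivclp identify xs ys \<longleftrightarrow> canon xs = canon ys"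
proof
  assume "equivclp identify xs ys"
  then show "canon xs = canon ys"
    by (induction rule: equivclp_induct) (auto dest: canon_identify)
next
  assume "canon xs = canon ys"
  then show "equivclp identify xs ys"
    by (metis identify_canon equivclp_sym equivclp_trans rtranclp_into_equivclp)
qed


section \<open>Moves and outcomes\<close>

text \<open>The effect of a move before identifications are applied.\<close>

inductive raw_move :: "nat list \<Rightarrow> nat list \<Rightarrow> bool" where
  raw_first: "1 \<le> k \<Longrightarrow> k \<le> x \<Longrightarrow> raw_move (x # xs) ((x - k) # xs)"
| raw_last: "1 \<le> k \<Longrightarrow> k \<le> x \<Longrightarrow> raw_move (xs @ [x]) (xs @ [x - k])"
| raw_pair: "1 \<le> k \<Longrightarrow> k \<le> x \<Longrightarrow> k \<le> y \<Longrightarrow>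
    raw_move (xs @ x # y # ys) (xs @ (x - k) # (y - k) # ys)"

text \<open>Moves are made from the sequence of positive integers, hence the inner \<open>canon\<close>.\<close>

definition options :: "nat list \<Rightarrow> nat list set" where
  "options s = {canon r | r. raw_move (canon s) r}"

text \<open>The least fixed point expresses that a win can be forced in finitely many moves.\<close>

inductive P_position :: "nat list \<Rightarrow> bool" and N_position :: "nat list \<Rightarrow> bool" where
  P_position_intro: "(\<And>t. t \<in> options s \<Longrightarrow> N_position t) \<Longrightarrow> P_position s"
| N_position_intro: "t \<in> options s \<Longrightarrow> P_position t \<Longrightarrow> N_position s"

lemma sum_list_raw_move: "raw_move s t \<Longrightarrow> sum_list t < sum_list s"
  by (induction rule: raw_move.induct) auto

lemma sum_list_option_less: "t \<in> options s \<Longrightarrow> sum_list t < sum_list s"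
  by (auto simp: options_def sum_list_canon dest!: sum_list_raw_move)

lemma N_position_iff: "N_position s \<longleftrightarrow> (\<exists>t \<in> options s. P_position t)"
  by (auto intro: N_position_intro elim: N_position.cases)

lemma P_position_iff_all_N: "P_position s \<longleftrightarrow> (\<forall>t \<in> options s. N_position t)"
  by (auto intro: P_position_intro elim: P_position.cases)

lemma P_position_xor_N_position: "P_position s \<longleftrightarrow> \<not> N_position s"
proof (induction "sum_list s" arbitrary: s rule: less_induct)
  case less
  have "P_position t \<longleftrightarrow> \<not> N_position t" if "t \<in> options s" for t
    using less sum_list_option_less[OF that] by simp
  then show ?case
    unfolding P_position_iff_all_N[of s] N_position_iff[of s] by blast
qed

lemma P_position_iff: "P_position s \<longleftrightarrow> (\<forall>t \<in> options s. \<not> P_position t)"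
  unfolding P_position_xor_N_position[of s] N_position_iff[of s] by blast

lemma options_canon: "options (canon s) = options s"
  by (simp add: options_def canon_id canon_positive)

lemma P_position_canon: "P_position (canon s) \<longleftrightarrow> P_position s"
  by (simp only: P_position_iff[of s] P_position_iff[of "canon s"] options_canon)

end

theory Submission
  imports Defs
begin

text \<open>Every move from \<open>(a, a, a)\<close> leaves, for some \<open>b < a\<close>, two consecutive stacks of
  size \<open>a\<close> and one of size \<open>b\<close>, or two consecutive stacks of size \<open>b\<close> and one of size \<open>a\<close>.
  Either way a single move restores the symmetry to \<open>(b, b, b)\<close>, a \<open>P\<close> position by induction.\<close>

text \<open>Being \<open>P\<close> is invariant under \<open>canon\<close>, so a winning reply can
  be recognised before identifications are applied to its result.\<close>

lemma not_P_position_if_raw_move: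
  assumes "raw_move (canon s) r" "P_position r"
  shows "\<not> P_position s"
  using assms P_position_iff[of s] P_position_canon[of r] by (auto simp: options_def)

lemma raw_move_triple_cases:
  assumes "raw_move [a, a, a] r"
  obtains b where "b < a" "r \<in> {[b, a, a], [a, a, b], [b, b, a], [a, b, b]}"
  using assms
proof cases
  case (raw_first k)
  then show thesis using that[of "a - k"] by auto
next
  case (raw_last k x xs)
  then show thesis using that[of "a - k"] by (auto simp: append_eq_Cons_conv)
next
  case (raw_pair k x y xs ys)
  then show thesis using that[of "a - k"] by (auto simp: Cons_eq_append_conv)
qed

lemma not_P_position_unbalanced_triple:
  assumes "b < a" "P_position [b, b, b]"
    and "s \<in> {[b, a, a], [a, a, b], [b, b, a], [a, b, b]}"
  shows "\<not> P_position s"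
proof (cases b)
  \<comment> \<open>For \<open>b = 0\<close> the list \<open>s\<close> contains zeros and collapses
    to \<open>[a, a]\<close> or \<open>[a]\<close>; the winning reply there empties the
    position.\<close>
  case 0
  have "P_position []" using assms(2) P_position_canon[of "[b, b, b]"] 0 by simp
  then have P: "P_position [0, 0]" "P_position [0]"
    using P_position_canon[of "[0, 0]"] P_position_canon[of "[0]"] by simp_all
  obtain c where a: "a = Suc c" using assms(1) by (cases a) auto
  have "raw_move [a, a] [0, 0]" "raw_move [a] [0]"
    using raw_pair[of a a a "[]" "[]"] raw_first[of a a "[]"] a by simp_all
  moreover have "canon s \<in> {[a, a], [a]}" using assms(3) a 0 by auto
  ultimately have "raw_move (canon s) [0, 0] \<or> raw_move (canon s) [0]" by auto
  then show ?thesis using P not_P_position_if_raw_move by blast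
next
  case (Suc c)
  have "canon s = s" using assms(1,3) Suc by (intro canon_id) auto
  \<comment> \<open>The reply removes \<open>a - b\<close> from every stack of size
    \<open>a\<close>: a consecutive pair or a single end stack.\<close>
  moreover have "raw_move s [b, b, b]"
    using assms(1,3) raw_first[of "a - b" a "[b, b]"] raw_last[of "a - b" a "[b, b]"]
      raw_pair[of "a - b" a a "[b]" "[]"] raw_pair[of "a - b" a a "[]" "[b]"] by auto
  ultimately show ?thesis using assms(2) not_P_position_if_raw_move by metis
qed

theorem theorem1:
  fixes a :: nat
  shows "P_position [a, a, a]"
proof (induction a rule: less_induct)
  case (less a)
  have "\<not> P_position t" if "t \<in> options [a, a, a]" for t
  proof -
    obtain r where r: "t = canon r" "raw_move (canon [a, a, a]) r"
      using \<open>t \<in> options [a, a, a]\<close> by (auto simp: options_def)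
    \<comment> \<open>The existence of a move excludes \<open>a = 0\<close>, where
      \<open>canon\<close> gives the empty list.\<close>
    have "canon [a, a, a] \<noteq> []" using r(2) by (auto elim: raw_move.cases)
    then have "canon [a, a, a] = [a, a, a]" by (cases a) auto
    then have "raw_move [a, a, a] r" using r(2) by simp
    then obtain b where "b < a" "r \<in> {[b, a, a], [a, a, b], [b, b, a], [a, b, b]}"
      by (rule raw_move_triple_cases)
    then have "\<not> P_position r"
      using not_P_position_unbalanced_triple less by blast
    then show ?thesis using r(1) P_position_canon[of r] by simp
  qed
  then show ?case using P_position_iff by blast
qed

end
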